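(* Set $D_{0}^+(x)=D_0(x)=1$ and $D_{0}^-(x)=T_0(x)=T_{0}^-(x)=T_{0}^+(x)=0$. Then for all $n\ge 0$, $$D^{+}_{n+1}(x)=nxR^{+}_n(x)+x(1-2x)\frac{d}{dx}R^{+}_n(x)+D_{n}(x),$$ $$T^{+}_{n+1}(x)=nxR^{+}_n(x)+x(1-2x)\frac{d}{dx}R^{+}_n(x)+T_{n}(x),$$ $$D^{-}_{n+1}(x)=(n+1)xR^{-}_n(x)+x(1-2x)\frac{d}{dx}R^{-}_n(x)+xT_{n}^+(x),$$ $$T^{-}_{n+1}(x)=(n+1)xR^{-}_n(x)+x(1-2x)\frac{d}{dx}R^{-}_n(x)+xD_{n}^+(x),$$ $$D_{n+1}(x)=(1+nx)D_n(x)+(n+1)xT_n(x)+x(1-2x)\frac{d}{dx}R_n(x)+xD^{-}_{n}(x),$$ $$T_{n+1}(x)=(1+nx)T_n(x)+(n+1)xD_n(x)+x(1-2x)\frac{d}{dx}R_n(x)+xT^{-}_{n}(x).$$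
   Context: Let $[n]=\{1,\dots,n\}$ and let $B_n$ be the group of signed permutations: permutations $\pi$ of $\{\pm1,\dots,\pm n\}$ with $\pi(-i)=-\pi(i)$. Each $\pi\in B_n$ is identified with the word $\pi(0)\pi(1)\cdots\pi(n)$, where $\pi(0)=0$. A double descent of $\pi\in B_n$ is an index $i\in[n-1]$ with $\pi(i-1)>\pi(i)>\pi(i+1)$ (so $i=1$ uses $\pi(0)=0$). A permutation $\pi\in B_n$ is a signed simsun permutation if for every $0\le k\le n$, the word obtained from $\pi$ by removing the $k$ entries $\pm n,\pm(n-1),\dots,\pm(n-k+1)$ (keeping the leading $0$ and the order of the remaining entries) is a signed permutation in $B_{n-k}$ with no double descents. Let $\mathcal{RB}_n$ be the set of signed simsun permutations in $B_n$. Let $\mathcal{RD}_n$ (resp. $\mathcal{RT}_n$) be the set of $\pi\in\mathcal{RB}_n$ such that $\{\pi(1),\dots,\pi(n)\}$ contains an even (resp. odd) number of negative terms. For $\mathcal{X}\in\{\mathcal{RB},\mathcal{RD},\mathcal{RT}\}$, $\mathcal{X}_n^{+}$ (resp. $\mathcal{X}_n^{-}$) denotes the subset of those $\pi\in\mathcal{X}_n$ with $\pi(1)>0$ (resp. $\pi(1)<0$). The type $B$ descent number is $\mathrm{des}_B(\pi)=|\{i\in\{0,1,\dots,n-1\}:\pi(i)>\pi(i+1)\}|$. For $n\ge 1$, $R_n(x),D_n(x),T_n(x)$ denote $\sum x^{\mathrm{des}_B(\pi)}$ over $\mathcal{RB}_n,\mathcal{RD}_n,\mathcal{RT}_n$ respectively,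 and $R_n^{\pm}(x),D_n^{\pm}(x),T_n^{\pm}(x)$ denote the same sums over $\mathcal{RB}_n^{\pm},\mathcal{RD}_n^{\pm},\mathcal{RT}_n^{\pm}$. For $n=0$: $R_0(x)=R_0^+(x)=1$, $R_0^-(x)=0$. *)

theory Defs
  imports "HOL-Combinatorics.Permutations" "HOL-Computational_Algebra.Polynomial"
begin

text \<open>
  A signed permutation is a function on all integers that permutes
  \<open>{-n, \<dots>, -1, 1, \<dots>, n}\<close>. It is the identity elsewhere, so \<open>\<pi> 0 = 0\<close>, and each
  signed permutation is represented by exactly one function.
\<close>

definition signed_perms :: "nat \<Rightarrow> (int \<Rightarrow> int) set" where
  "signed_perms n =
     {\<pi>. \<pi> permutes ({- int n..int n} - {0}) \<and> (\<forall>i. \<pi> (- i) = - \<pi> i)}"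

definition signed_word :: "nat \<Rightarrow> (int \<Rightarrow> int) \<Rightarrow> int list" where
  "signed_word n \<pi> = map \<pi> [0..int n]"

definition double_descent :: "nat \<Rightarrow> (int \<Rightarrow> int) \<Rightarrow> int \<Rightarrow> bool" where
  "double_descent n \<pi> i \<longleftrightarrow>
     i \<in> {1..int n - 1} \<and> \<pi> (i - 1) > \<pi> i \<and> \<pi> i > \<pi> (i + 1)"

text \<open>
  Removing \<open>\<plusminus>n, \<dots>, \<plusminus>(n - k + 1)\<close> from a word keeps the entries of absolute value
  at most \<open>n - k\<close>, in particular the leading \<open>0\<close>.
\<close>

definition RB :: "nat \<Rightarrow> (int \<Rightarrow> int) set" where
  "RB n = {\<pi> \<in> signed_perms n. \<forall>k\<le>n. \<exists>\<sigma> \<in> signed_perms (n - k).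
     signed_word (n - k) \<sigma> = filter (\<lambda>a. \<bar>a\<bar> \<le> int (n - k)) (signed_word n \<pi>) \<and>
     \<not> (\<exists>i. double_descent (n - k) \<sigma> i)}"

definition neg_terms :: "nat \<Rightarrow> (int \<Rightarrow> int) \<Rightarrow> int set" where
  "neg_terms n \<pi> = {a \<in> \<pi> ` {1..int n}. a < 0}"

definition RD :: "nat \<Rightarrow> (int \<Rightarrow> int) set" where
  "RD n = {\<pi> \<in> RB n. even (card (neg_terms n \<pi>))}"

definition RT :: "nat \<Rightarrow> (int \<Rightarrow> int) set" where
  "RT n = {\<pi> \<in> RB n. odd (card (neg_terms n \<pi>))}"

definition pos_part :: "(int \<Rightarrow> int) set \<Rightarrow> (int \<Rightarrow> int) set" where
  "pos_part X = {\<pi> \<in> X. \<pi> 1 > 0}"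

definition neg_part :: "(int \<Rightarrow> int) set \<Rightarrow> (int \<Rightarrow> int) set" where
  "neg_part X = {\<pi> \<in> X. \<pi> 1 < 0}"

definition des_B :: "nat \<Rightarrow> (int \<Rightarrow> int) \<Rightarrow> nat" where
  "des_B n \<pi> = card {i \<in> {0..int n - 1}. \<pi> i > \<pi> (i + 1)}"

definition des_poly :: "nat \<Rightarrow> (int \<Rightarrow> int) set \<Rightarrow> int poly" where
  "des_poly n X = (\<Sum>\<pi>\<in>X. monom 1 (des_B n \<pi>))"

text \<open>The values at \<open>n = 0\<close> are conventions, since there is no entry \<open>\<pi> 1\<close> to speak of.\<close>

definition R_poly :: "nat \<Rightarrow> int poly" where
  "R_poly n = (if n = 0 then 1 else des_poly n (RB n))"

definition R_pos :: "nat \<Rightarrow> int poly" where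
  "R_pos n = (if n = 0 then 1 else des_poly n (pos_part (RB n)))"

definition R_neg :: "nat \<Rightarrow> int poly" where
  "R_neg n = (if n = 0 then 0 else des_poly n (neg_part (RB n)))"

definition D_poly :: "nat \<Rightarrow> int poly" where
  "D_poly n = (if n = 0 then 1 else des_poly n (RD n))"

definition D_pos :: "nat \<Rightarrow> int poly" where
  "D_pos n = (if n = 0 then 1 else des_poly n (pos_part (RD n)))"

definition D_neg :: "nat \<Rightarrow> int poly" where
  "D_neg n = (if n = 0 then 0 else des_poly n (neg_part (RD n)))"

definition T_poly :: "nat \<Rightarrow> int poly" where
  "T_poly n = (if n = 0 then 0 else des_poly n (RT n))"

definition T_pos :: "nat \<Rightarrow> int poly" where
  "T_pos n = (if n = 0 then 0 else des_poly n (pos_part (RT n)))"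

definition T_neg :: "nat \<Rightarrow> int poly" where
  "T_neg n = (if n = 0 then 0 else des_poly n (neg_part (RT n)))"

abbreviation X :: "int poly" where
  "X \<equiv> monom 1 1"

end

theory Submission
  imports Defs
begin

text \<open>
  Deleting \<open>\<plusminus>(n + 1)\<close> from a signed simsun word leaves a signed simsun word with one
  letter less. Conversely, inserting \<open>M = n + 1\<close> or \<open>- M\<close> behind some letter of a word \<open>w\<close> of
  length \<open>n\<close> gives a signed simsun word as soon as it creates no double descent
  (\<open>simsun_words_Suc\<close>). So the words of length \<open>n + 1\<close> split into fibres over the words of length
  \<open>n\<close>, and the recurrences follow by summing \<open>x ^ des\<close> over one fibre at a time
  (\<open>word_poly_Suc\<close>).

  Let \<open>w\<close> have \<open>d\<close> descents and no double descent. Inserting \<open>M\<close> into a descent or at the end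
  leaves \<open>d\<close> unchanged. Inserting \<open>M\<close> into an ascent adds a descent, and is forbidden if
  a descent follows. Every descent follows an ascent, except a descent at the very front. If \<open>f\<close>
  is 1 or 0 according to whether \<open>w\<close> starts with a descent, this gives
  \<open>(1 + d) x ^ d + (n - 2 d + f) x ^ (d + 1)\<close> (\<open>sum_list_insert_max\<close>). Symmetrically, inserting
  \<open>- M\<close> into a descent leaves \<open>d\<close> unchanged, while inserting it into an ascent or at the end
  adds a descent and is forbidden right after a descent. This gives
  \<open>d x ^ d + (n + 1 - 2 d) x ^ (d + 1)\<close> (\<open>sum_list_insert_min\<close>).

  The sign of \<open>\<pi> 1\<close> changes only if the new letter is placed right after the leading 0, and the
  parity of the number of negative letters changes exactly if \<open>- M\<close> is inserted. Hence the sum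
  over a fibre can be refined by both data. In the refined sums
  (\<open>sum_insertions_by_second\<close>) the main part \<open>d x ^ d + (k - 2 d) x ^ (d + 1)\<close>, where \<open>k\<close> is
  \<open>n\<close> or \<open>n + 1\<close>, does not depend on the parity of \<open>w\<close>. It is the image of \<open>x ^ d\<close> under the
  operator \<open>k x + x (1 - 2 x) d/dx\<close>, since \<open>x d/dx\<close> multiplies \<open>x ^ d\<close> by \<open>d\<close>
  (\<open>word_poly_derivative\<close>). Summed over all \<open>w\<close> with the relevant sign, it therefore contributes
  this operator applied to \<open>R\<^sup>+\<close> or \<open>R\<^sup>-\<close>. What remains is at most one monomial per word. This proves the first four recurrences, and adding the positive and negative parts gives
  the last two.
\<close>

section \<open>Descents and insertions in words\<close>

fun no_double_descent :: "int list \<Rightarrow> bool" where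
  "no_double_descent (a # b # c # xs) \<longleftrightarrow> \<not> (a > b \<and> b > c) \<and> no_double_descent (b # c # xs)"
| "no_double_descent _ \<longleftrightarrow> True"

fun num_descents :: "int list \<Rightarrow> nat" where
  "num_descents (a # b # xs) = (if a > b then 1 else 0) + num_descents (b # xs)"
| "num_descents _ = 0"

definition num_negative :: "int list \<Rightarrow> nat" where
  "num_negative w = length (filter (\<lambda>a. a < 0) w)"

text \<open>
  This is the condition \<open>\<pi> 1 < 0\<close> for the word of \<open>\<pi>\<close>, which starts with \<open>\<pi> 0\<close>. The one-letter
  word counts as positive, which agrees with the conventions for \<open>n = 0\<close>.
\<close>
definition second_negative :: "int list \<Rightarrow> bool" where
  "second_negative w \<longleftrightarrow> length w > 1 \<and> w ! 1 < 0"

lemma no_double_descent_Cons: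
  "no_double_descent (a # w) \<longleftrightarrow>
     no_double_descent w \<and> \<not> (length w > 1 \<and> a > w ! 0 \<and> w ! 0 > w ! 1)"
  by (cases w rule: no_double_descent.cases) auto

lemma no_double_descent_nth:
  "no_double_descent w \<longleftrightarrow> (\<forall>i. i + 2 < length w \<longrightarrow> \<not> (w ! i > w ! (i + 1) \<and> w ! (i + 1) > w ! (i + 2)))"
proof (induction w)
  case (Cons a w)
  have "(\<forall>i. i + 2 < length (a # w) \<longrightarrow> \<not> ((a # w) ! i > (a # w) ! (i + 1) \<and> (a # w) ! (i + 1) > (a # w) ! (i + 2)))
    \<longleftrightarrow> \<not> (length w > 1 \<and> a > w ! 0 \<and> w ! 0 > w ! 1) \<and>
      (\<forall>i. i + 2 < length w \<longrightarrow> \<not> (w ! i > w ! (i + 1) \<and> w ! (i + 1) > w ! (i + 2)))"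
    (is "(\<forall>i. ?P i) \<longleftrightarrow> _")
  proof -
    have "(\<forall>i. ?P i) \<longleftrightarrow> ?P 0 \<and> (\<forall>i. ?P (Suc i))"
      by (metis not0_implies_Suc)
    then show ?thesis by (auto simp: numeral_2_eq_2)
  qed
  then show ?case
    by (simp only: no_double_descent_Cons Cons.IH) blast
qed simp

lemma num_descents_card:
  "num_descents w = card {i. i + 1 < length w \<and> w ! i > w ! (i + 1)}"
proof (induction w rule: num_descents.induct)
  case (1 a b xs)
  let ?S = "\<lambda>w :: int list. {i. i + 1 < length w \<and> w ! i > w ! (i + 1)}"
  have fin: "finite (?S (b # xs))"
    by (rule finite_subset[of _ "{..<length (b # xs)}"]) auto
  have "?S (a # b # xs) = (if a > b then {0} else {}) \<union> Suc ` ?S (b # xs)"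
    (is "?L = ?R")
  proof (rule set_eqI)
    fix i show "i \<in> ?L \<longleftrightarrow> i \<in> ?R"
      by (cases i) auto
  qed
  moreover have "card \<dots> = (if a > b then 1 else 0) + card (?S (b # xs))"
    using fin by (subst card_Un_disjoint) (auto simp: card_image)
  ultimately show ?case using 1 by simp
qed auto

text \<open>
  The new letter is never placed in front, since words keep their leading 0. The result is a list
  of words, one for each position, so that sums over positions can be computed by recursion.
\<close>
fun insertions :: "int \<Rightarrow> int list \<Rightarrow> int list list" where
  "insertions e [] = []"
| "insertions e (a # xs) = (a # e # xs) # map ((#) a) (insertions e xs)"

lemma in_insertions_iff:
  "v \<in> set (insertions e w) \<longleftrightarrow> (\<exists>us vs. us \<noteq> [] \<and> w = us @ vs \<and> v = us @ e # vs)"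
proof (induction w arbitrary: v)
  case (Cons a w)
  show ?case
  proof
    assume "v \<in> set (insertions e (a # w))"
    then consider "v = a # e # w" | u where "v = a # u" "u \<in> set (insertions e w)" by auto
    then show "\<exists>us vs. us \<noteq> [] \<and> a # w = us @ vs \<and> v = us @ e # vs"
    proof cases
      case 1
      then show ?thesis by (intro exI[of _ "[a]"] exI[of _ w]) auto
    next
      case 2
      then obtain us vs where "w = us @ vs" "u = us @ e # vs" using Cons.IH by blast
      with 2 show ?thesis by (intro exI[of _ "a # us"] exI[of _ vs]) auto
    qed
  next
    assume "\<exists>us vs. us \<noteq> [] \<and> a # w = us @ vs \<and> v = us @ e # vs"
    then obtain us vs where *: "w = us @ vs" "v = a # us @ e # vs"
      by (auto simp: Cons_eq_append_conv)
    show "v \<in> set (insertions e (a # w))"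
    proof (cases "us = []")
      case False
      then have "us @ e # vs \<in> set (insertions e w)" using * Cons.IH by blast
      then show ?thesis using * by auto
    qed (use * in auto)
  qed
qed simp

lemma distinct_insertions: "e \<notin> set w \<Longrightarrow> distinct (insertions e w)"
proof (induction w)
  case (Cons a w)
  have "e # w \<notin> set (insertions e w)"
    using Cons.prems by (auto simp: in_insertions_iff Cons_eq_append_conv)
  then show ?case using Cons by (auto simp: distinct_map)
qed simp

section \<open>Inserting a largest or smallest letter\<close>

text \<open>
  Forbidden insertions get weight 0, so that sums run over all positions.
\<close>
definition word_weight :: "int list \<Rightarrow> int poly" where
  "word_weight v = (if no_double_descent v then monom 1 (num_descents v) else 0)"

lemma hd_insertions: "v \<in> set (insertions e (b # xs)) \<Longrightarrow> v \<noteq> [] \<and> v ! 0 = b"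
  by auto

lemma word_weight_Cons_ascent:
  assumes "v \<noteq> []" "a < v ! 0"
  shows "word_weight (a # v) = word_weight v"
  using assms by (cases v) (auto simp: word_weight_def no_double_descent_Cons)

lemma word_weight_Cons_descent:
  assumes "length v > 1" "a > v ! 0" "v ! 0 \<le> v ! 1"
  shows "word_weight (a # v) = X * word_weight v"
  using assms by (cases v) (auto simp: word_weight_def no_double_descent_Cons mult_monom)

lemma word_weight_double_descent:
  assumes "length v > 1" "a > v ! 0" "v ! 0 > v ! 1"
  shows "word_weight (a # v) = 0"
  using assms by (auto simp: word_weight_def no_double_descent_Cons)

text \<open>
  The coefficient of the second term counts the ascents that are not followed by a descent: there
  are \<open>length w - 1 - d\<close> ascents, and each of the \<open>d\<close> descents except one at the front has an
  ascent right before it. The induction removes the first letter \<open>a\<close>. Insertions further right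
  either keep their weight or are multiplied by \<open>X\<close>, depending on whether \<open>a\<close> starts a descent. In
  the latter case the second letter is the bottom of a descent, and no insertion of \<open>M\<close> can
  make it descend further.
\<close>
lemma sum_list_insert_max:
  assumes "no_double_descent w" "w \<noteq> []" "distinct w" "\<forall>a\<in>set w. a < M"
  shows "(\<Sum>v\<leftarrow>insertions M w. word_weight v) =
     (1 + of_nat (num_descents w)) * monom 1 (num_descents w) +
     (of_nat (length w) - 1 - 2 * of_nat (num_descents w)
        + (if length w > 1 \<and> w ! 0 > w ! 1 then 1 else 0)) * X * monom 1 (num_descents w)"
  using assms
proof (induction w rule: num_descents.induct)
  case (1 a b xs)
  have IH: "(\<Sum>v\<leftarrow>insertions M (b # xs). word_weight v) =
     (1 + of_nat (num_descents (b # xs))) * monom 1 (num_descents (b # xs)) +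
     (of_nat (length xs) - 2 * of_nat (num_descents (b # xs))
        + (if xs \<noteq> [] \<and> b > xs ! 0 then 1 else 0)) * X * monom 1 (num_descents (b # xs))"
    using 1 by (simp add: no_double_descent_Cons)
  define d where "d = num_descents (b # xs)"
  have d: "num_descents (b # xs) = d" "monom 1 (Suc d) = X * monom 1 d"
    by (simp_all add: d_def mult_monom)
  have ab: "a \<noteq> b" "a < M" "b < M" "\<forall>x\<in>set xs. x < M" using "1.prems" by auto
  have nxs: "no_double_descent (b # xs)" using "1.prems" by (simp add: no_double_descent_Cons)
  show ?case
  proof (cases "a < b")
    case True
    have "(\<Sum>v\<leftarrow>insertions M (b # xs). word_weight (a # v)) = (\<Sum>v\<leftarrow>insertions M (b # xs). word_weight v)"
      using True hd_insertions by (intro arg_cong[of _ _ sum_list] map_cong refl word_weight_Cons_ascent) metis+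
    moreover have "word_weight (a # M # b # xs) =
      (if xs \<noteq> [] \<and> b > xs ! 0 then 0 else X * monom 1 (num_descents (b # xs)))"
      using nxs ab True by (cases xs) (auto simp: word_weight_def no_double_descent_Cons mult_monom)
    ultimately show ?thesis using True IH
      by (simp add: d o_def algebra_simps)
  next
    case False
    then have "a > b" using ab by simp
    have up: "xs \<noteq> [] \<Longrightarrow> b < xs ! 0" using "1.prems" \<open>a > b\<close>
      by (cases xs) auto
    have "(\<Sum>v\<leftarrow>insertions M (b # xs). word_weight (a # v)) = (\<Sum>v\<leftarrow>insertions M (b # xs). X * word_weight v)"
    proof (intro arg_cong[of _ _ sum_list] map_cong refl word_weight_Cons_descent)
      fix v assume v: "v \<in> set (insertions M (b # xs))"
      then show "length v > 1" by (cases xs) (auto simp: in_insertions_iff)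
      show "a > v ! 0" using v \<open>a > b\<close> by auto
      show "v ! 0 \<le> v ! 1" using v ab up by (cases xs) auto
    qed
    moreover have "word_weight (a # M # b # xs) = monom 1 (Suc (num_descents (b # xs)))"
      using nxs ab up by (cases xs) (auto simp: word_weight_def no_double_descent_Cons)
    ultimately have "(\<Sum>v\<leftarrow>insertions M (a # b # xs). word_weight v) =
        X * monom 1 d + X * (\<Sum>v\<leftarrow>insertions M (b # xs). word_weight v)"
      by (simp only: insertions.simps(2)[of M a] list.map sum_list.Cons map_map o_def d sum_list_const_mult)
    then show ?thesis unfolding IH using \<open>a > b\<close> up
      by (auto simp: d algebra_simps)
  qed
qed (auto simp: word_weight_def)

text \<open>
  The coefficient of the second term counts the positions, including the end, that are neither a
  descent nor right after one. There are \<open>length w\<close> positions in all. Each of the \<open>d\<close> descents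
  excludes itself and the next position, and no position is excluded twice because there is no
  double descent. In the induction, a new first letter \<open>a\<close> that starts a descent makes exactly one
  further insertion illegal, the one right after the second letter.
\<close>
lemma sum_list_insert_min:
  assumes "no_double_descent w" "w \<noteq> []" "distinct w" "\<forall>a\<in>set w. m < a"
  shows "(\<Sum>v\<leftarrow>insertions m w. word_weight v) =
     of_nat (num_descents w) * monom 1 (num_descents w) +
     (of_nat (length w) - 2 * of_nat (num_descents w)) * X * monom 1 (num_descents w)"
  using assms
proof (induction w rule: num_descents.induct)
  case (1 a b xs)
  have IH: "(\<Sum>v\<leftarrow>insertions m (b # xs). word_weight v) =
     of_nat (num_descents (b # xs)) * monom 1 (num_descents (b # xs)) +
     (of_nat (length xs) + 1 - 2 * of_nat (num_descents (b # xs))) * X * monom 1 (num_descents (b # xs))"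
    using 1 by (simp add: no_double_descent_Cons)
  define d where "d = num_descents (b # xs)"
  have d: "num_descents (b # xs) = d" "monom 1 (Suc d) = X * monom 1 d"
    by (simp_all add: d_def mult_monom)
  have ab: "a \<noteq> b" "m < a" "m < b" "\<forall>x\<in>set xs. m < x" using "1.prems" by auto
  have nxs: "no_double_descent (b # xs)" using "1.prems" by (simp add: no_double_descent_Cons)
  have first: "word_weight (a # m # b # xs) = X * monom 1 (num_descents (b # xs))"
    using nxs ab by (cases xs) (auto simp: word_weight_def no_double_descent_Cons mult_monom)
  show ?case
  proof (cases "a < b")
    case True
    have "(\<Sum>v\<leftarrow>insertions m (b # xs). word_weight (a # v)) = (\<Sum>v\<leftarrow>insertions m (b # xs). word_weight v)"
      using True hd_insertions by (intro arg_cong[of _ _ sum_list] map_cong refl word_weight_Cons_ascent) metis+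
    then show ?thesis using True IH first
      by (simp add: d o_def algebra_simps)
  next
    case False
    then have "a > b" using ab by simp
    have up: "xs \<noteq> [] \<Longrightarrow> b < xs ! 0" using "1.prems" \<open>a > b\<close>
      by (cases xs) auto
    have "(\<Sum>v\<leftarrow>insertions m xs. word_weight (a # b # v)) = (\<Sum>v\<leftarrow>insertions m xs. X * word_weight (b # v))"
    proof (intro arg_cong[of _ _ sum_list] map_cong refl word_weight_Cons_descent)
      fix v assume v: "v \<in> set (insertions m xs)"
      then show "length (b # v) > 1" by (auto simp: in_insertions_iff)
      show "a > (b # v) ! 0" using v \<open>a > b\<close> by auto
      show "(b # v) ! 0 \<le> (b # v) ! 1" using v ab up by (cases xs) auto
    qed
    \<comment> \<open>The insertion that \<open>a\<close> makes illegal had weight \<open>X * monom 1 d\<close> in the shorter word, and is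
      subtracted below.\<close>
    moreover have "word_weight (a # b # m # xs) = 0"
      using ab \<open>a > b\<close> by (intro word_weight_double_descent) auto
    moreover have "word_weight (b # m # xs) = X * monom 1 (num_descents (b # xs))"
      using nxs ab up by (cases xs) (auto simp: word_weight_def no_double_descent_Cons mult_monom)
    ultimately have "(\<Sum>v\<leftarrow>insertions m (a # b # xs). word_weight v) =
        X * monom 1 d + X * ((\<Sum>v\<leftarrow>insertions m (b # xs). word_weight v) - X * monom 1 d)"
      using first
      by (simp only: insertions.simps(2) list.map sum_list.Cons map_map o_def d sum_list_const_mult) simp
    then show ?thesis unfolding IH using \<open>a > b\<close>
      by (simp add: d algebra_simps)
  qed
qed (auto simp: word_weight_def mult_monom)

section \<open>Signed permutations as words\<close>

definition signed_words :: "nat \<Rightarrow> int list set" where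
  "signed_words n = {w. w \<noteq> [] \<and> w ! 0 = 0 \<and> distinct (map abs w) \<and> abs ` set w = {0..int n}}"

definition simsun_words :: "nat \<Rightarrow> int list set" where
  "simsun_words n =
     {w \<in> signed_words n. \<forall>m\<le>n. no_double_descent (filter (\<lambda>a. \<bar>a\<bar> \<le> int m) w)}"

lemma length_signed_words: "w \<in> signed_words n \<Longrightarrow> length w = Suc n"
proof -
  assume w: "w \<in> signed_words n"
  then have "length w = card (set (map abs w))"
    unfolding signed_words_def by (metis (mono_tags) distinct_card length_map mem_Collect_eq)
  also have "\<dots> = Suc n" using w by (simp add: signed_words_def)
  finally show ?thesis .
qed

lemma signed_words_abs_le: "w \<in> signed_words n \<Longrightarrow> a \<in> set w \<Longrightarrow> \<bar>a\<bar> \<le> int n"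
  unfolding signed_words_def by (smt (verit) atLeastAtMost_iff image_eqI mem_Collect_eq)

lemma filter_in_signed_words:
  assumes "w \<in> signed_words n" "m \<le> n"
  shows "filter (\<lambda>a. \<bar>a\<bar> \<le> int m) w \<in> signed_words m"
proof -
  obtain xs where w: "w = 0 # xs" using assms by (cases w) (auto simp: signed_words_def)
  have "abs ` {x \<in> set w. \<bar>x\<bar> \<le> int m} = {a \<in> abs ` set w. a \<le> int m}" by auto
  also have "\<dots> = {0..int m}" using assms by (auto simp: signed_words_def)
  finally have "abs ` set (filter (\<lambda>a. \<bar>a\<bar> \<le> int m) w) = {0..int m}" by simp
  moreover have "distinct (map abs (filter (\<lambda>a. \<bar>a\<bar> \<le> int m) w))"
    using assms by (auto simp: signed_words_def distinct_map_filter)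
  ultimately show ?thesis by (simp add: signed_words_def w)
qed

text \<open>
  Distinct indices could only have values of equal absolute value if \<open>\<pi> i = \<pi> (- j)\<close>, which
  injectivity and oddness exclude. So \<open>i \<mapsto> \<bar>\<pi> i\<bar>\<close> permutes \<open>{0..n}\<close>.
\<close>
lemma signed_word_in_signed_words:
  assumes "\<pi> \<in> signed_perms n"
  shows "signed_word n \<pi> \<in> signed_words n"
proof -
  have perm: "\<pi> permutes ({- int n..int n} - {0})" and odd: "\<And>i. \<pi> (- i) = - \<pi> i"
    using assms by (auto simp: signed_perms_def)
  have inj: "inj \<pi>" using perm permutes_inj by blast
  have "inj_on (\<lambda>i. \<bar>\<pi> i\<bar>) {0..int n}"
  proof (rule inj_onI)
    fix i j assume ij: "i \<in> {0..int n}" "j \<in> {0..int n}" "\<bar>\<pi> i\<bar> = \<bar>\<pi> j\<bar>"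
    then have "\<pi> i = \<pi> j \<or> \<pi> i = \<pi> (- j)" using odd by (auto simp: abs_eq_iff)
    then have "i = j \<or> i = - j" using inj by (auto dest: injD)
    then show "i = j" using ij by auto
  qed
  moreover have z: "\<pi> 0 = 0" using perm by (simp add: permutes_def)
  moreover have "(\<lambda>i. \<bar>\<pi> i\<bar>) ` {0..int n} \<subseteq> {0..int n}"
  proof (rule image_subsetI)
    fix i assume "i \<in> {0..int n}"
    then show "\<bar>\<pi> i\<bar> \<in> {0..int n}"
      using z permutes_in_image[OF perm, of i] by (cases "i = 0") auto
  qed
  moreover from calculation have "(\<lambda>i. \<bar>\<pi> i\<bar>) ` {0..int n} = {0..int n}"
    by (intro endo_inj_surj) auto
  ultimately show ?thesis
    by (simp add: signed_words_def signed_word_def distinct_map image_image comp_inj_on_iff o_def inj_on_def) metis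
qed

lemma nth_signed_word: "k \<le> n \<Longrightarrow> signed_word n \<pi> ! k = \<pi> (int k)"
  by (simp add: signed_word_def)

lemma length_signed_word: "length (signed_word n \<pi>) = Suc n"
  by (simp add: signed_word_def)

lemma ex_signed_perm:
  assumes w: "w \<in> signed_words n"
  shows "\<exists>\<pi>\<in>signed_perms n. signed_word n \<pi> = w"
proof -
  \<comment> \<open>The odd extension of the word. At 0 the factor \<open>sgn i\<close> gives 0 as required.\<close>
  define \<pi> where "\<pi> i = (if \<bar>i\<bar> \<le> int n then sgn i * w ! nat \<bar>i\<bar> else i)" for i
  let ?S = "{- int n..int n} - {0}"
  have len: "length w = Suc n" using length_signed_words[OF w] .
  have w0: "w ! 0 = 0" using w by (simp add: signed_words_def)
  have dist: "\<bar>w ! j\<bar> = \<bar>w ! k\<bar> \<Longrightarrow> j \<le> n \<Longrightarrow> k \<le> n \<Longrightarrow> j = k" for j k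
    using w len nth_eq_iff_index_eq[of "map abs w" j k] by (simp add: signed_words_def)
  have abs_pi: "\<bar>\<pi> i\<bar> = \<bar>w ! nat \<bar>i\<bar>\<bar>" if "i \<in> ?S" for i
    using that by (auto simp: \<pi>_def abs_mult)
  have nz: "w ! nat \<bar>i\<bar> \<noteq> 0" if "i \<in> ?S" for i
  proof
    assume "w ! nat \<bar>i\<bar> = 0"
    then have "nat \<bar>i\<bar> = 0" using that w0 by (intro dist) auto
    then show False using that by simp
  qed
  have "inj_on \<pi> ?S"
  proof (rule inj_onI)
    fix i j assume ij: "i \<in> ?S" "j \<in> ?S" "\<pi> i = \<pi> j"
    then have "\<bar>w ! nat \<bar>i\<bar>\<bar> = \<bar>w ! nat \<bar>j\<bar>\<bar>" using abs_pi by metis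
    then have "nat \<bar>i\<bar> = nat \<bar>j\<bar>" using ij by (intro dist) auto
    then have eq: "\<bar>i\<bar> = \<bar>j\<bar>" by simp
    have "w ! nat \<bar>j\<bar> \<noteq> 0" using nz ij(2) .
    moreover have "sgn i * w ! nat \<bar>j\<bar> = sgn j * w ! nat \<bar>j\<bar>"
      using ij eq by (auto simp: \<pi>_def split: if_splits)
    ultimately have "sgn i = sgn j" by simp
    then show "i = j" using eq by (metis sgn_mult_abs)
  qed
  moreover have "\<pi> ` ?S \<subseteq> ?S"
  proof (rule image_subsetI)
    fix i assume i: "i \<in> ?S"
    have "w ! nat \<bar>i\<bar> \<noteq> 0" using nz i .
    then have "\<bar>\<pi> i\<bar> \<noteq> 0" using abs_pi[OF i] by simp
    moreover have "\<bar>\<pi> i\<bar> \<le> int n"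
      using abs_pi[OF i] i signed_words_abs_le[OF w nth_mem, of "nat \<bar>i\<bar>"] len by auto
    ultimately show "\<pi> i \<in> ?S" by auto
  qed
  ultimately have "bij_betw \<pi> ?S ?S"
    using endo_inj_surj[of ?S \<pi>] by (simp add: bij_betw_def)
  moreover have "\<pi> i = i" if "i \<notin> ?S" for i
    using that w0 by (auto simp: \<pi>_def)
  ultimately have "\<pi> permutes ?S" by (rule bij_imp_permutes)
  moreover have "\<pi> (- i) = - \<pi> i" for i by (simp add: \<pi>_def sgn_minus)
  ultimately have "\<pi> \<in> signed_perms n" by (simp add: signed_perms_def)
  moreover have "signed_word n \<pi> = w"
  proof (rule nth_equalityI)
    fix k assume "k < length (signed_word n \<pi>)"
    then show "signed_word n \<pi> ! k = w ! k"
      using w0 by (cases "k = 0") (auto simp: nth_signed_word length_signed_word \<pi>_def)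
  qed (simp add: len length_signed_word)
  ultimately show ?thesis by blast
qed

lemma inj_on_signed_word: "inj_on (signed_word n) (signed_perms n)"
proof (rule inj_onI)
  fix \<pi> \<sigma> assume p: "\<pi> \<in> signed_perms n" and s: "\<sigma> \<in> signed_perms n"
    and eq: "signed_word n \<pi> = signed_word n \<sigma>"
  have nonneg: "\<pi> i = \<sigma> i" if "0 \<le> i" for i
  proof (cases "i \<le> int n")
    case True
    then show ?thesis using that eq nth_signed_word[of "nat i" n] by (metis nat_0_le nat_le_iff)
  next
    case False
    then show ?thesis using p s by (simp add: signed_perms_def permutes_def)
  qed
  show "\<pi> = \<sigma>"
  proof
    fix i show "\<pi> i = \<sigma> i"
    proof (cases "0 \<le> i")
      case False
      then have "\<pi> (- i) = \<sigma> (- i)" by (intro nonneg) simp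
      then show ?thesis using p s by (simp add: signed_perms_def)
    qed (rule nonneg)
  qed
qed

lemma double_descent_iff_word:
  "(\<exists>i. double_descent n \<pi> i) \<longleftrightarrow> \<not> no_double_descent (signed_word n \<pi>)"
proof -
  have "(\<exists>i. double_descent n \<pi> i) \<longleftrightarrow> (\<exists>k. double_descent n \<pi> (int k + 1))"
  proof
    assume "\<exists>i. double_descent n \<pi> i"
    then obtain i where "double_descent n \<pi> i" ..
    then show "\<exists>k. double_descent n \<pi> (int k + 1)"
      by (intro exI[of _ "nat (i - 1)"]) (auto simp: double_descent_def)
  qed blast
  also have "\<dots> \<longleftrightarrow> (\<exists>k. k + 2 \<le> n \<and> \<pi> (int k) > \<pi> (int (k + 1)) \<and> \<pi> (int (k + 1)) > \<pi> (int (k + 2)))"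
    by (intro ex_cong1) (auto simp: double_descent_def algebra_simps)
  also have "\<dots> \<longleftrightarrow> \<not> no_double_descent (signed_word n \<pi>)"
    unfolding no_double_descent_nth by (auto simp: length_signed_word nth_signed_word Suc_le_eq)
  finally show ?thesis .
qed

text \<open>
  Every filtered word is again the word of a signed permutation, so the existential quantifier over
  \<open>\<sigma>\<close> in the definition of \<open>RB\<close> is a condition on the filtered word alone.
\<close>
lemma RB_iff_word: "\<pi> \<in> RB n \<longleftrightarrow> \<pi> \<in> signed_perms n \<and> signed_word n \<pi> \<in> simsun_words n"
proof -
  have *: "(\<exists>\<sigma>\<in>signed_perms m. signed_word m \<sigma> = filter (\<lambda>a. \<bar>a\<bar> \<le> int m) (signed_word n \<pi>) \<and>
     \<not> (\<exists>i. double_descent m \<sigma> i)) \<longleftrightarrow> no_double_descent (filter (\<lambda>a. \<bar>a\<bar> \<le> int m) (signed_word n \<pi>))"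
    if "\<pi> \<in> signed_perms n" "m \<le> n" for m
    using ex_signed_perm[OF filter_in_signed_words[OF signed_word_in_signed_words[OF that(1)] that(2)]]
    unfolding double_descent_iff_word by metis
  have all: "(\<forall>k\<le>n. P (n - k)) \<longleftrightarrow> (\<forall>m\<le>n. P m)" for P
    by (metis diff_diff_cancel diff_le_self)
  show ?thesis
    unfolding RB_def simsun_words_def mem_Collect_eq
      all[of "\<lambda>m. \<exists>\<sigma>\<in>signed_perms m. signed_word m \<sigma> = filter (\<lambda>a. \<bar>a\<bar> \<le> int m) (signed_word n \<pi>) \<and>
        \<not> (\<exists>i. double_descent m \<sigma> i)"]
    using signed_word_in_signed_words * by metis
qed

lemma bij_betw_RB: "bij_betw (signed_word n) (RB n) (simsun_words n)"
  unfolding bij_betw_def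
proof
  show "inj_on (signed_word n) (RB n)"
    by (rule inj_on_subset[OF inj_on_signed_word]) (auto simp: RB_iff_word)
  show "signed_word n ` RB n = simsun_words n"
  proof (rule set_eqI)
    fix w show "w \<in> signed_word n ` RB n \<longleftrightarrow> w \<in> simsun_words n"
      using ex_signed_perm[of w n] by (auto simp: RB_iff_word simsun_words_def)
  qed
qed

lemma des_B_word: "des_B n \<pi> = num_descents (signed_word n \<pi>)"
proof -
  have "{i \<in> {0..int n - 1}. \<pi> i > \<pi> (i + 1)} = int ` {k. k + 1 < Suc n \<and> \<pi> (int k) > \<pi> (int (k + 1))}"
  proof (intro equalityI subsetI)
    fix i assume "i \<in> {i \<in> {0..int n - 1}. \<pi> i > \<pi> (i + 1)}"
    then show "i \<in> int ` {k. k + 1 < Suc n \<and> \<pi> (int k) > \<pi> (int (k + 1))}"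
      by (intro image_eqI[of _ _ "nat i"]) (auto simp: add.commute)
  qed (auto simp: add.commute)
  then have "des_B n \<pi> = card {k. k + 1 < Suc n \<and> \<pi> (int k) > \<pi> (int (k + 1))}"
    by (simp add: des_B_def card_image)
  also have "{k. k + 1 < Suc n \<and> \<pi> (int k) > \<pi> (int (k + 1))} =
    {k. k + 1 < Suc n \<and> signed_word n \<pi> ! k > signed_word n \<pi> ! (k + 1)}"
    by (auto simp: nth_signed_word)
  finally show ?thesis by (simp add: num_descents_card length_signed_word)
qed

lemma card_neg_terms_word:
  assumes "\<pi> \<in> signed_perms n"
  shows "card (neg_terms n \<pi>) = num_negative (signed_word n \<pi>)"
proof -
  have w: "signed_word n \<pi> \<in> signed_words n" using assms by (rule signed_word_in_signed_words)
  have "{0..int n} = insert 0 {1..int n}" by auto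
  moreover have "\<pi> 0 = 0" using assms by (simp add: signed_perms_def permutes_def)
  ultimately have "neg_terms n \<pi> = set (filter (\<lambda>a. a < 0) (signed_word n \<pi>))"
    by (auto simp: neg_terms_def signed_word_def)
  moreover have "distinct (signed_word n \<pi>)" using w by (simp add: signed_words_def distinct_map)
  ultimately show ?thesis
    by (metis distinct_card distinct_filter num_negative_def)
qed

lemma second_negative_word:
  assumes "\<pi> \<in> signed_perms n" "n > 0"
  shows "\<pi> 1 < 0 \<longleftrightarrow> second_negative (signed_word n \<pi>)"
    and "\<pi> 1 > 0 \<longleftrightarrow> \<not> second_negative (signed_word n \<pi>)"
proof -
  have "\<pi> 1 \<in> {- int n..int n} - {0}"
    using assms permutes_in_image[of \<pi> "{- int n..int n} - {0}" 1] by (auto simp: signed_perms_def)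
  then show "\<pi> 1 < 0 \<longleftrightarrow> second_negative (signed_word n \<pi>)"
    and "\<pi> 1 > 0 \<longleftrightarrow> \<not> second_negative (signed_word n \<pi>)"
    using assms nth_signed_word[of 1 n \<pi>] by (auto simp: second_negative_def length_signed_word)
qed

section \<open>Descent polynomials of sets of words\<close>

definition word_poly :: "nat \<Rightarrow> (int list \<Rightarrow> bool) \<Rightarrow> int poly" where
  "word_poly n P = (\<Sum>w\<in>simsun_words n. of_bool (P w) * monom 1 (num_descents w))"

lemma finite_simsun_words: "finite (simsun_words n)"
proof (rule finite_subset)
  show "simsun_words n \<subseteq> {w. set w \<subseteq> {- int n..int n} \<and> length w = Suc n}"
    using signed_words_abs_le length_signed_words by (fastforce simp: simsun_words_def abs_le_iff)
  show "finite {w. set w \<subseteq> {- int n..int n} \<and> length w = Suc n}"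
    by (rule finite_lists_length_eq) simp
qed

lemma des_poly_word:
  assumes "\<And>\<pi>. \<pi> \<in> signed_perms n \<Longrightarrow> \<pi> \<in> A \<longleftrightarrow> \<pi> \<in> RB n \<and> P (signed_word n \<pi>)" "A \<subseteq> RB n"
  shows "des_poly n A = word_poly n P"
proof -
  have A: "A = {\<pi> \<in> RB n. P (signed_word n \<pi>)}" using assms by (auto simp: RB_iff_word)
  have fin: "finite (RB n)" using bij_betw_finite[OF bij_betw_RB] finite_simsun_words by blast
  have "word_poly n P = (\<Sum>\<pi>\<in>RB n. of_bool (P (signed_word n \<pi>)) * monom 1 (des_B n \<pi>))"
    unfolding word_poly_def des_B_word by (rule sum.reindex_bij_betw[OF bij_betw_RB, symmetric])
  also have "\<dots> = (\<Sum>\<pi>\<in>RB n. if P (signed_word n \<pi>) then monom 1 (des_B n \<pi>) else 0)"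
    by (rule sum.cong) auto
  also have "\<dots> = des_poly n A"
    unfolding des_poly_def A using fin by (simp add: sum.inter_filter)
  finally show ?thesis by simp
qed

lemma simsun_words_0: "simsun_words 0 = {[0]}"
proof
  show "simsun_words 0 \<subseteq> {[0]}"
  proof
    fix w assume w: "w \<in> simsun_words 0"
    then have "length w = 1" "w ! 0 = 0"
      using length_signed_words[of w 0] by (auto simp: simsun_words_def signed_words_def)
    then show "w \<in> {[0]}" by (auto simp: length_Suc_conv)
  qed
qed (auto simp: simsun_words_def signed_words_def)

lemma word_poly_0: "word_poly 0 P = of_bool (P [0])"
  by (simp add: word_poly_def simsun_words_0)

text \<open>
  All nine polynomials are descent polynomials of words, and this includes the conventional
  values at \<open>n = 0\<close>, where the only word is \<open>[0]\<close>.
\<close>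
lemma polys_as_word_polys:
  "R_poly n = word_poly n (\<lambda>w. True)"
  "R_pos n = word_poly n (\<lambda>w. \<not> second_negative w)"
  "R_neg n = word_poly n second_negative"
  "D_poly n = word_poly n (\<lambda>w. even (num_negative w))"
  "D_pos n = word_poly n (\<lambda>w. even (num_negative w) \<and> \<not> second_negative w)"
  "D_neg n = word_poly n (\<lambda>w. even (num_negative w) \<and> second_negative w)"
  "T_poly n = word_poly n (\<lambda>w. odd (num_negative w))"
  "T_pos n = word_poly n (\<lambda>w. odd (num_negative w) \<and> \<not> second_negative w)"
  "T_neg n = word_poly n (\<lambda>w. odd (num_negative w) \<and> second_negative w)"
  unfolding R_poly_def R_pos_def R_neg_def D_poly_def D_pos_def D_neg_def T_poly_def T_pos_def T_neg_def
  by (cases "n = 0"; auto simp: word_poly_0 second_negative_def[of "[0]"] num_negative_def[of "[0]"]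
        pos_part_def neg_part_def RD_def RT_def card_neg_terms_word second_negative_word intro!: des_poly_word)+

section \<open>Removing the letter of largest absolute value\<close>

lemma insertion_signed_words:
  assumes "us \<noteq> []" "\<bar>e\<bar> = int (Suc n)"
  shows "us @ e # vs \<in> signed_words (Suc n) \<longleftrightarrow> us @ vs \<in> signed_words n"
proof -
  define S where "S = abs ` set (us @ vs)"
  have hd: "(us @ e # vs) ! 0 = (us @ vs) ! 0" using assms by (cases us) auto
  have dist: "distinct (map abs (us @ e # vs)) \<longleftrightarrow>
     distinct (map abs (us @ vs)) \<and> int (Suc n) \<notin> S"
    using assms by (auto simp: S_def)
  have set: "abs ` set (us @ e # vs) = insert (int (Suc n)) S"
    using assms by (auto simp: S_def)
  have "{0..int (Suc n)} = insert (int (Suc n)) {0..int n}" by auto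
  then have "int (Suc n) \<notin> S \<and> insert (int (Suc n)) S = {0..int (Suc n)} \<longleftrightarrow> S = {0..int n}"
    using insert_ident[of "int (Suc n)" S "{0..int n}"] by auto
  then show ?thesis
    using assms(1) unfolding signed_words_def mem_Collect_eq hd dist set S_def[symmetric]
    by blast
qed

text \<open>
  Below level \<open>n + 1\<close> the new letter is filtered out, so both words satisfy the same conditions, and
  at level \<open>n + 1\<close> nothing is filtered out, so one condition on the whole new word is left.
\<close>
lemma insertion_simsun_words:
  assumes "us \<noteq> []" "\<bar>e\<bar> = int (Suc n)"
  shows "us @ e # vs \<in> simsun_words (Suc n) \<longleftrightarrow> us @ vs \<in> simsun_words n \<and> no_double_descent (us @ e # vs)"
proof -
  define N where "N m v \<longleftrightarrow> no_double_descent (filter (\<lambda>a. \<bar>a\<bar> \<le> int m) v)" for m v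
  have "filter (\<lambda>a. \<bar>a\<bar> \<le> int (Suc n)) (us @ e # vs) = us @ e # vs" if "us @ e # vs \<in> signed_words (Suc n)"
    using signed_words_abs_le[OF that] by (simp only: filter_id_conv) blast
  then have top: "us @ e # vs \<in> signed_words (Suc n) \<Longrightarrow> N (Suc n) (us @ e # vs) \<longleftrightarrow> no_double_descent (us @ e # vs)"
    by (simp only: N_def)
  have "N m (us @ e # vs) \<longleftrightarrow> N m (us @ vs)" if "m \<le> n" for m
    using assms that by (simp add: N_def)
  then have below: "(\<forall>m\<le>n. N m (us @ e # vs)) \<longleftrightarrow> (\<forall>m\<le>n. N m (us @ vs))"
    by blast
  have "(\<forall>m\<le>Suc n. N m (us @ e # vs)) \<longleftrightarrow> N (Suc n) (us @ e # vs) \<and> (\<forall>m\<le>n. N m (us @ e # vs))"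
    by (auto simp: le_Suc_eq)
  then show ?thesis
    using top below unfolding simsun_words_def mem_Collect_eq insertion_signed_words[OF assms, symmetric] N_def[symmetric]
    by blast
qed

lemma simsun_words_Suc:
  "v \<in> simsun_words (Suc n) \<longleftrightarrow> no_double_descent v \<and>
     (\<exists>w\<in>simsun_words n. \<exists>e. \<bar>e\<bar> = int (Suc n) \<and> v \<in> set (insertions e w))"
proof
  assume v: "v \<in> simsun_words (Suc n)"
  then have sw: "abs ` set v = {0..int (Suc n)}" "v ! 0 = 0" by (auto simp: simsun_words_def signed_words_def)
  then have "int (Suc n) \<in> abs ` set v" by simp
  then obtain e where e: "e \<in> set v" "\<bar>e\<bar> = int (Suc n)" by fastforce
  then obtain us vs where split: "v = us @ e # vs" by (meson split_list)
  have us: "us \<noteq> []" using split sw e by auto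
  show "no_double_descent v \<and> (\<exists>w\<in>simsun_words n. \<exists>e. \<bar>e\<bar> = int (Suc n) \<and> v \<in> set (insertions e w))"
  proof (intro conjI bexI[of _ "us @ vs"] exI[of _ e])
    show "no_double_descent v" "us @ vs \<in> simsun_words n"
      using insertion_simsun_words[OF us e(2), of vs] v split by auto
    show "v \<in> set (insertions e (us @ vs))"
      using split us by (auto simp: in_insertions_iff)
  qed (rule e(2))
next
  assume v: "no_double_descent v \<and> (\<exists>w\<in>simsun_words n. \<exists>e. \<bar>e\<bar> = int (Suc n) \<and> v \<in> set (insertions e w))"
  then obtain w e where we: "w \<in> simsun_words n" "\<bar>e\<bar> = int (Suc n)" "v \<in> set (insertions e w)" by blast
  obtain us vs where us: "us \<noteq> []" "w = us @ vs" "v = us @ e # vs"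
    using we(3) by (auto simp: in_insertions_iff)
  then show "v \<in> simsun_words (Suc n)"
    using v we(1) insertion_simsun_words[OF us(1) we(2), of vs] by simp
qed

lemma filter_insertion:
  assumes "w \<in> simsun_words n" "\<bar>e\<bar> = int (Suc n)" "v \<in> set (insertions e w)"
  shows "filter (\<lambda>a. \<bar>a\<bar> \<le> int n) v = w"
proof -
  obtain us vs where split: "w = us @ vs" "v = us @ e # vs" using assms(3) by (auto simp: in_insertions_iff)
  then have "w = us @ vs" by simp
  moreover have "\<forall>a\<in>set w. \<bar>a\<bar> \<le> int n"
    using assms(1) signed_words_abs_le by (auto simp: simsun_words_def)
  ultimately have "filter (\<lambda>a. \<bar>a\<bar> \<le> int n) us = us" "filter (\<lambda>a. \<bar>a\<bar> \<le> int n) vs = vs"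
    by (simp_all add: filter_id_conv)
  then show ?thesis using assms(2) split by (simp only: filter_append) simp
qed

text \<open>
  The fibre of the filter map over \<open>w\<close> consists of the legal insertions into \<open>w\<close>. These are
  pairwise distinct because the new letter does not occur in \<open>w\<close>.
\<close>
lemma word_poly_Suc:
  "word_poly (Suc n) P = (\<Sum>w\<in>simsun_words n.
     (\<Sum>v\<leftarrow>insertions (int (Suc n)) w. of_bool (P v) * word_weight v) +
     (\<Sum>v\<leftarrow>insertions (- int (Suc n)) w. of_bool (P v) * word_weight v))"
proof -
  let ?M = "int (Suc n)"
  let ?I = "\<lambda>w. insertions ?M w @ insertions (- ?M) w"
  let ?f = "\<lambda>v. of_bool (P v) * word_weight v"
  let ?r = "filter (\<lambda>a. \<bar>a\<bar> \<le> int n)"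
  have in_I: "v \<in> set (?I w) \<longleftrightarrow> (\<exists>e. \<bar>e\<bar> = ?M \<and> v \<in> set (insertions e w))" for v w
  proof -
    have "\<bar>e\<bar> = ?M \<longleftrightarrow> e = ?M \<or> e = - ?M" for e by linarith
    then show ?thesis unfolding set_append Un_iff by metis
  qed
  have r: "?r v = w" if "w \<in> simsun_words n" "v \<in> set (?I w)" for v w
    using that(2) filter_insertion[OF that(1)] by (simp only: in_I) (elim exE conjE)
  have fib: "{v \<in> simsun_words (Suc n). ?r v = w} = {v \<in> set (?I w). no_double_descent v}"
    if w: "w \<in> simsun_words n" for w
  proof (intro set_eqI iffI)
    fix v assume v: "v \<in> {v \<in> simsun_words (Suc n). ?r v = w}"
    then obtain w' where w': "w' \<in> simsun_words n" "v \<in> set (?I w')" "no_double_descent v"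
      unfolding mem_Collect_eq simsun_words_Suc in_I by (elim conjE bexE)
    moreover have "w' = w" using r[OF w'(1,2)] v by simp
    ultimately show "v \<in> {v \<in> set (?I w). no_double_descent v}" by blast
  next
    fix v assume v: "v \<in> {v \<in> set (?I w). no_double_descent v}"
    then have "v \<in> simsun_words (Suc n)"
      unfolding mem_Collect_eq simsun_words_Suc in_I using w by (elim conjE) (intro conjI bexI)
    then show "v \<in> {v \<in> simsun_words (Suc n). ?r v = w}" using r[OF w] v by blast
  qed
  have dist: "distinct (?I w)" if w: "w \<in> simsun_words n" for w
  proof -
    have "e \<notin> set w" if "\<bar>e\<bar> = ?M" for e
      using that w signed_words_abs_le[of w n e] by (auto simp: simsun_words_def)
    moreover have "set (insertions ?M w) \<inter> set (insertions (- ?M) w) = {}"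
    proof -
      have "?M \<in> set v" if "v \<in> set (insertions ?M w)" for v
        using that by (auto simp: in_insertions_iff)
      moreover have "?M \<notin> set v" if "v \<in> set (insertions (- ?M) w)" for v
        using that calculation(1) \<open>\<And>e. \<bar>e\<bar> = ?M \<Longrightarrow> e \<notin> set w\<close>[of ?M] by (auto simp: in_insertions_iff)
      ultimately show ?thesis by blast
    qed
    ultimately show ?thesis by (simp add: distinct_insertions del: of_nat_Suc)
  qed
  have img: "?r ` simsun_words (Suc n) \<subseteq> simsun_words n"
  proof (rule image_subsetI)
    fix v assume "v \<in> simsun_words (Suc n)"
    then obtain w where "w \<in> simsun_words n" "v \<in> set (?I w)"
      unfolding simsun_words_Suc in_I by (elim conjE bexE)
    then show "?r v \<in> simsun_words n" using r[of w v] by simp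
  qed
  have "word_poly (Suc n) P = (\<Sum>v\<in>simsun_words (Suc n). ?f v)"
    unfolding word_poly_def by (rule sum.cong) (auto simp: word_weight_def simsun_words_Suc)
  also have "\<dots> = (\<Sum>w\<in>simsun_words n. \<Sum>v\<in>{v \<in> simsun_words (Suc n). ?r v = w}. ?f v)"
    by (rule sum.group[symmetric]) (use img finite_simsun_words in auto)
  also have "\<dots> = (\<Sum>w\<in>simsun_words n. \<Sum>v\<in>set (?I w). ?f v)"
  proof (rule sum.cong[OF refl])
    fix w assume w: "w \<in> simsun_words n"
    show "(\<Sum>v\<in>{v \<in> simsun_words (Suc n). ?r v = w}. ?f v) = (\<Sum>v\<in>set (?I w). ?f v)"
      unfolding fib[OF w] by (rule sum.mono_neutral_left) (auto simp: word_weight_def)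
  qed
  also have "\<dots> = (\<Sum>w\<in>simsun_words n. \<Sum>v\<leftarrow>?I w. ?f v)"
    by (intro sum.cong refl) (simp only: sum_list_distinct_conv_sum_set[OF dist])
  finally show ?thesis by simp
qed

section \<open>Sign of the first entry and parity of the negative entries\<close>

lemma num_negative_insertion:
  assumes "v \<in> set (insertions e w)"
  shows "num_negative v = num_negative w + of_bool (e < 0)"
  using assms by (auto simp: in_insertions_iff num_negative_def)

lemma second_negative_insertions_tail:
  "v \<in> set (insertions e (b # xs)) \<Longrightarrow> second_negative (a # v) \<longleftrightarrow> b < 0"
  by (auto simp: second_negative_def)

text \<open>
  The first position, right after the leading 0, makes \<open>e\<close> the second letter. At all other
  positions the second letter remains \<open>b\<close>. The number of negative letters is the same for all
  positions.
\<close>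
lemma sum_list_insertions_by_second:
  assumes w: "w = 0 # b # xs" and m: "m = num_negative w + of_bool (e < 0)"
  shows "(\<Sum>v\<leftarrow>insertions e w. of_bool (Q (num_negative v) \<and> (second_negative v \<longleftrightarrow> c)) * word_weight v) =
    of_bool (Q m) * (of_bool ((e < 0) \<longleftrightarrow> c) * word_weight (0 # e # b # xs)
      + of_bool ((b < 0) \<longleftrightarrow> c) * ((\<Sum>v\<leftarrow>insertions e w. word_weight v) - word_weight (0 # e # b # xs)))"
proof -
  have "(\<Sum>v\<leftarrow>insertions e w. of_bool (Q (num_negative v) \<and> (second_negative v \<longleftrightarrow> c)) * word_weight v) =
    (\<Sum>v\<leftarrow>insertions e w. of_bool (Q m \<and> (second_negative v \<longleftrightarrow> c)) * word_weight v)"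
    using num_negative_insertion[of _ e w] m by (intro arg_cong[of _ _ sum_list] map_cong refl) simp
  also have "\<dots> = of_bool (Q m \<and> ((e < 0) \<longleftrightarrow> c)) * word_weight (0 # e # b # xs) +
     (\<Sum>v\<leftarrow>insertions e (b # xs). of_bool (Q m \<and> (second_negative (0 # v) \<longleftrightarrow> c)) * word_weight (0 # v))"
    unfolding w insertions.simps(2)[of e 0] by (simp add: o_def second_negative_def)
  also have "(\<Sum>v\<leftarrow>insertions e (b # xs). of_bool (Q m \<and> (second_negative (0 # v) \<longleftrightarrow> c)) * word_weight (0 # v)) =
     (\<Sum>v\<leftarrow>insertions e (b # xs). of_bool (Q m \<and> ((b < 0) \<longleftrightarrow> c)) * word_weight (0 # v))"
    by (intro arg_cong[of _ _ sum_list] map_cong refl) (simp only: second_negative_insertions_tail)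
  also have "\<dots> = of_bool (Q m \<and> ((b < 0) \<longleftrightarrow> c)) *
      ((\<Sum>v\<leftarrow>insertions e w. word_weight v) - word_weight (0 # e # b # xs))"
    unfolding w insertions.simps(2)[of e 0] sum_list_const_mult by (simp add: o_def)
  finally show ?thesis by (cases "Q m") simp_all
qed

text \<open>
  The parameter \<open>p\<close> prescribes the parity (\<open>True\<close> for even) and the second argument of \<open>S\<close> the
  sign of the second letter of the inserted word. Of \<open>M\<close> and \<open>- M\<close>, exactly one insertion gives
  the parity \<open>p\<close>. The words of positive sign come from all insertions of \<open>M\<close> if \<open>w\<close> is positive,
  from all insertions of \<open>- M\<close> but the first if \<open>w\<close> is positive, and from the first insertion of
  \<open>M\<close> if \<open>w\<close> is negative. The words of negative sign come from the remaining insertions. The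
  sums for the two possible parities of \<open>w\<close> differ by at most one monomial.
\<close>
lemma sum_insertions_by_second:
  fixes p :: bool
  assumes w: "w \<in> simsun_words n"
  defines "d \<equiv> num_descents w"
  defines "S \<equiv> \<lambda>e c. (\<Sum>v\<leftarrow>insertions e w.
     of_bool ((even (num_negative v) \<longleftrightarrow> p) \<and> (second_negative v \<longleftrightarrow> c)) * word_weight v)"
  shows "S (int (Suc n)) False + S (- int (Suc n)) False =
     of_bool (\<not> second_negative w) * (of_nat d * monom 1 d + (of_nat n - 2 * of_nat d) * X * monom 1 d)
       + of_bool (even (num_negative w) \<longleftrightarrow> p) * monom 1 d" (is ?pos)
   and "S (int (Suc n)) True + S (- int (Suc n)) True =
     of_bool (second_negative w) * (of_nat d * monom 1 d + (of_nat (n + 1) - 2 * of_nat d) * X * monom 1 d)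
       + X * (of_bool (\<not> (even (num_negative w) \<longleftrightarrow> p) \<and> \<not> second_negative w) * monom 1 d)" (is ?neg)
proof -
  have sw: "w \<in> signed_words n" using w by (simp add: simsun_words_def)
  have len: "length w = Suc n" using sw by (rule length_signed_words)
  have bound: "\<forall>a\<in>set w. \<bar>a\<bar> \<le> int n" using sw signed_words_abs_le by blast
  have "filter (\<lambda>a. \<bar>a\<bar> \<le> int n) w = w" using bound by (simp add: filter_id_conv)
  moreover have "no_double_descent (filter (\<lambda>a. \<bar>a\<bar> \<le> int n) w)"
    using w by (simp add: simsun_words_def)
  ultimately have ndd: "no_double_descent w" by simp
  have dist: "distinct w" using sw by (simp add: signed_words_def distinct_map)
  have "?pos \<and> ?neg"
  proof (cases n)
    case 0
    then have w0: "w = [0]" using w by (simp add: simsun_words_0)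
    show ?thesis
      by (simp add: S_def d_def w0 0 num_negative_def second_negative_def word_weight_def)
  next
    case (Suc n')
    have "w ! 0 = 0" using sw by (simp add: signed_words_def)
    then obtain b xs where wb: "w = 0 # b # xs"
      using len Suc by (cases w rule: num_descents.cases) auto
    have "b \<noteq> 0" using dist wb by auto
    have dd: "d = (if b < 0 then 1 else 0) + num_descents (b # xs)" by (simp add: d_def wb)
    have ndb: "no_double_descent (b # xs)" using ndd wb by (simp add: no_double_descent_Cons)
    have bn: "\<bar>b\<bar> \<le> int n" using bound wb by simp
    have sn: "second_negative w \<longleftrightarrow> b < 0" by (simp add: wb second_negative_def)
    have first_descent: "Suc n > 1 \<and> w ! 0 > w ! 1 \<longleftrightarrow> b < 0" and nonempty: "w \<noteq> []"
      by (simp_all add: wb Suc)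
    have below: "\<forall>a\<in>set w. a < int (Suc n)" and above: "\<forall>a\<in>set w. - int (Suc n) < a"
      using bound by fastforce+
    have max: "(\<Sum>v\<leftarrow>insertions (int (Suc n)) w. word_weight v) =
      (1 + of_nat d) * monom 1 d + (of_nat n - 2 * of_nat d + of_bool (b < 0)) * X * monom 1 d"
      unfolding sum_list_insert_max[OF ndd nonempty dist below] len first_descent
      by (simp add: d_def)
    have min: "(\<Sum>v\<leftarrow>insertions (- int (Suc n)) w. word_weight v) =
      of_nat d * monom 1 d + (of_nat n + 1 - 2 * of_nat d) * X * monom 1 d"
      unfolding sum_list_insert_min[OF ndd nonempty dist above] len
      by (simp add: d_def)
    \<comment> \<open>Position 0 is a descent if \<open>b < 0\<close>, so inserting \<open>M\<close> there is legal and keeps \<open>d\<close>.\<close>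
    have max0: "word_weight (0 # int (Suc n) # b # xs) = monom 1 d" if "b < 0"
    proof -
      have "xs \<noteq> [] \<Longrightarrow> b < xs ! 0" using ndd dist that unfolding wb by (cases xs) auto
      then show ?thesis using that ndb bn dd
        by (cases xs) (auto simp: word_weight_def no_double_descent_Cons)
    qed
    have min0: "word_weight (0 # - int (Suc n) # b # xs) = X * monom 1 (num_descents (b # xs))"
      using ndb bn by (cases xs) (auto simp: word_weight_def no_double_descent_Cons mult_monom)
    have S: "S e c = of_bool (even (num_negative w + of_bool (e < 0)) \<longleftrightarrow> p) *
      (of_bool ((e < 0) \<longleftrightarrow> c) * word_weight (0 # e # b # xs)
      + of_bool ((b < 0) \<longleftrightarrow> c) * ((\<Sum>v\<leftarrow>insertions e w. word_weight v) - word_weight (0 # e # b # xs)))" for e c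
      unfolding S_def by (rule sum_list_insertions_by_second[OF wb refl])
    show ?thesis
    proof (cases "b < 0")
      case True
      then show ?thesis
        unfolding S max min max0[OF True] sn
        by (cases "even (num_negative w)"; cases p) (simp_all add: algebra_simps)
    next
      case False
      then have "word_weight (0 # - int (Suc n) # b # xs) = X * monom 1 d"
        using min0 dd by simp
      with False show ?thesis
        unfolding S max min sn
        by (cases "even (num_negative w)"; cases p) (simp_all add: algebra_simps)
    qed
  qed
  then show ?pos ?neg by blast+
qed

lemma X_mult_pderiv_monom: "X * pderiv (monom 1 d) = of_nat d * monom 1 d"
proof -
  have "of_nat d * monom (1 :: int) d = monom (of_nat d) d"
    by (simp add: of_nat_poly smult_monom)
  then show ?thesis by (cases d) (simp_all add: pderiv_monom mult_monom)
qed

text \<open>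
  The operator \<open>k X + X (1 - 2 X) d/dX\<close> sends \<open>X ^ d\<close> to \<open>d X ^ d + (k - 2 d) X ^ (d + 1)\<close>.
\<close>
lemma word_poly_derivative:
  "(\<Sum>w\<in>simsun_words n. of_bool (P w) * (of_nat (num_descents w) * monom 1 (num_descents w)
     + (of_nat k - 2 * of_nat (num_descents w)) * X * monom 1 (num_descents w)))
   = of_nat k * X * word_poly n P + X * (1 - 2 * X) * pderiv (word_poly n P)"
proof -
  have deriv_sum: "pderiv (sum f A) = (\<Sum>a\<in>A. pderiv (f a))" for f :: "int list \<Rightarrow> int poly" and A
    by (induction A rule: infinite_finite_induct) (simp_all add: pderiv_add)
  have deriv: "pderiv (of_bool Q * q) = of_bool Q * pderiv q" for Q and q :: "int poly"
    by simp
  have "of_nat k * X * word_poly n P + X * (1 - 2 * X) * pderiv (word_poly n P) =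
    (\<Sum>w\<in>simsun_words n. of_nat k * X * (of_bool (P w) * monom 1 (num_descents w)) +
      (1 - 2 * X) * of_bool (P w) * (X * pderiv (monom 1 (num_descents w))))"
    unfolding word_poly_def deriv_sum sum_distrib_left sum.distrib[symmetric]
    by (intro sum.cong refl) (simp only: deriv, simp only: mult_ac)
  also have "\<dots> = (\<Sum>w\<in>simsun_words n. of_bool (P w) * (of_nat (num_descents w) * monom 1 (num_descents w)
     + (of_nat k - 2 * of_nat (num_descents w)) * X * monom 1 (num_descents w)))"
    unfolding X_mult_pderiv_monom by (intro sum.cong refl) (simp add: algebra_simps)
  finally show ?thesis by simp
qed

lemma word_poly_Suc_positive:
  "word_poly (Suc n) (\<lambda>v. (even (num_negative v) \<longleftrightarrow> p) \<and> \<not> second_negative v) =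
     of_nat n * X * R_pos n + X * (1 - 2 * X) * pderiv (R_pos n)
       + word_poly n (\<lambda>w. even (num_negative w) \<longleftrightarrow> p)"
proof -
  have *: "(\<not> second_negative v) = (second_negative v \<longleftrightarrow> False)" for v by simp
  show ?thesis
    unfolding polys_as_word_polys(2) word_poly_derivative[symmetric]
    unfolding word_poly_Suc word_poly_def[of n] sum.distrib[symmetric]
    unfolding * using sum_insertions_by_second(1)[of _ n p] by (intro sum.cong refl) simp
qed

lemma word_poly_Suc_negative:
  "word_poly (Suc n) (\<lambda>v. (even (num_negative v) \<longleftrightarrow> p) \<and> second_negative v) =
     of_nat (n + 1) * X * R_neg n + X * (1 - 2 * X) * pderiv (R_neg n)
       + X * word_poly n (\<lambda>w. \<not> (even (num_negative w) \<longleftrightarrow> p) \<and> \<not> second_negative w)"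
  unfolding polys_as_word_polys(3) word_poly_derivative[symmetric]
  unfolding word_poly_Suc word_poly_def[of n] sum.distrib[symmetric] sum_distrib_left
  using sum_insertions_by_second(2)[of _ n p] by (intro sum.cong refl) simp

lemma word_poly_split:
  "word_poly n P = word_poly n (\<lambda>w. P w \<and> \<not> Q w) + word_poly n (\<lambda>w. P w \<and> Q w)"
  unfolding word_poly_def sum.distrib[symmetric] by (intro sum.cong) auto

theorem proposition7:
  fixes n :: nat
  shows
    "D_pos (Suc n) = of_nat n * X * R_pos n + X * (1 - 2 * X) * pderiv (R_pos n) + D_poly n \<and>
     T_pos (Suc n) = of_nat n * X * R_pos n + X * (1 - 2 * X) * pderiv (R_pos n) + T_poly n \<and>
     D_neg (Suc n) = of_nat (n + 1) * X * R_neg n + X * (1 - 2 * X) * pderiv (R_neg n)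
        + X * T_pos n \<and>
     T_neg (Suc n) = of_nat (n + 1) * X * R_neg n + X * (1 - 2 * X) * pderiv (R_neg n)
        + X * D_pos n \<and>
     D_poly (Suc n) = (1 + of_nat n * X) * D_poly n + of_nat (n + 1) * X * T_poly n
        + X * (1 - 2 * X) * pderiv (R_poly n) + X * D_neg n \<and>
     T_poly (Suc n) = (1 + of_nat n * X) * T_poly n + of_nat (n + 1) * X * D_poly n
        + X * (1 - 2 * X) * pderiv (R_poly n) + X * T_neg n"
proof -
  have D_pos: "D_pos (Suc n) = of_nat n * X * R_pos n + X * (1 - 2 * X) * pderiv (R_pos n) + D_poly n"
    using word_poly_Suc_positive[of n True] by (simp only: polys_as_word_polys simp_thms)
  have T_pos: "T_pos (Suc n) = of_nat n * X * R_pos n + X * (1 - 2 * X) * pderiv (R_pos n) + T_poly n"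
    using word_poly_Suc_positive[of n False] by (simp only: polys_as_word_polys simp_thms)
  have D_neg: "D_neg (Suc n) = of_nat (n + 1) * X * R_neg n + X * (1 - 2 * X) * pderiv (R_neg n) + X * T_pos n"
    using word_poly_Suc_negative[of n True] by (simp only: polys_as_word_polys simp_thms)
  have T_neg: "T_neg (Suc n) = of_nat (n + 1) * X * R_neg n + X * (1 - 2 * X) * pderiv (R_neg n) + X * D_pos n"
    using word_poly_Suc_negative[of n False] by (simp only: polys_as_word_polys simp_thms)
  have D: "D_poly m = D_pos m + D_neg m" and T: "T_poly m = T_pos m + T_neg m" for m
    unfolding polys_as_word_polys by (rule word_poly_split)+
  have R: "R_poly m = R_pos m + R_neg m" for m
    using word_poly_split[of m "\<lambda>w. True" second_negative] by (simp only: polys_as_word_polys simp_thms)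
  have R_pos: "R_pos n = D_pos n + T_pos n"
    using word_poly_split[of n "\<lambda>w. \<not> second_negative w" "\<lambda>w. odd (num_negative w)"]
    by (simp only: polys_as_word_polys not_not conj_commute)
  have R_neg: "R_neg n = D_neg n + T_neg n"
    using word_poly_split[of n second_negative "\<lambda>w. odd (num_negative w)"]
    by (simp only: polys_as_word_polys not_not conj_commute)
  have "D_poly (Suc n) = (1 + of_nat n * X) * D_poly n + of_nat (n + 1) * X * T_poly n
        + X * (1 - 2 * X) * pderiv (R_poly n) + X * D_neg n"
    unfolding D[of "Suc n"] D_pos D_neg R pderiv_add unfolding R_pos R_neg D T pderiv_add
    by (simp add: algebra_simps)
  moreover have "T_poly (Suc n) = (1 + of_nat n * X) * T_poly n + of_nat (n + 1) * X * D_poly n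
        + X * (1 - 2 * X) * pderiv (R_poly n) + X * T_neg n"
    unfolding T[of "Suc n"] T_pos T_neg R pderiv_add unfolding R_pos R_neg D T pderiv_add
    by (simp add: algebra_simps)
  ultimately show ?thesis using D_pos T_pos D_neg T_neg by blast
qed

end
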